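(* Let $\mathcal H_i,\mathcal H_o$ be finite-dimensional complex Hilbert spaces, let $\widetilde P_i:\mathcal L(\mathcal H_i)\to\mathcal L(\mathcal H_i)$ be a linear, self-adjoint and unital projective map that commutes with transposition, and let $\{\widetilde P_{ia}\}_a$ be an extension of it, indexed by the finite-dimensional auxiliary spaces $\mathcal H_a$. Let $\gamma_i,\gamma_o$ and, for each $\mathcal H_a$, $\gamma_{ia},\gamma_{oa}$ be nonzero complex numbers with $\gamma_{oa}/\gamma_{ia}=\gamma_o/\gamma_i$. Suppose that for all $\mathcal H_a$ $$\widetilde P_{ia}[X_i\otimes\mathbb 1_a]=\widetilde P_i[X_i]\otimes\mathbb 1_a\qquad\text{for all }X_i\in\mathcal L(\mathcal H_i).$$ Then complete trace-rescaling adds no new restriction over trace-rescaling: every linear map $\widetilde T_{io}:\mathcal L(\mathcal H_i)\to\mathcal L(\mathcal H_o)$ that is trace-rescaling, i.e. $\operatorname{tr}[\widetilde T_{io}[W]]=\frac{\gamma_o}{\gamma_i}\operatorname{tr}[W]$ for all $W\in\mathcal L(\mathcal H_i)$ with $\widetilde P_i[W]=W$ and $\operatorname{tr}[W]=\gamma_i$, is completely trace-rescaling, i.e. for all $\mathcal H_a$, $\operatorname{tr}\big[(\widetilde T_{io}\otimes\widetilde{\mathbb 1}_a)[W_{ia}]\big]=\frac{\gamma_{oa}}{\gamma_{ia}}\operatorname{tr}[W_{ia}]$ for all $W_{ia}\in\mathcal L(\mathcal H_i\otimes\mathcal H_a)$ with $\widetilde P_{ia}[W_{ia}]=W_{ia}$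 and $\operatorname{tr}[W_{ia}]=\gamma_{ia}$.
   Context: $\mathcal L(\mathcal H)$ is the space of linear operators on $\mathcal H$; $\widetilde{\mathbb 1}_a$ is the identity map on $\mathcal L(\mathcal H_a)$. All Hilbert spaces carry fixed computational bases, with product bases on tensor products; $\tau$ is transposition in these bases. Projective map (projector): a linear map with $\widetilde P^2=\widetilde P$. Adjoint: $\operatorname{tr}[B^\dagger\widetilde P[A]]=\operatorname{tr}[\widetilde P^\dagger[B]^\dagger A]$ for all $A,B$; self-adjoint: $\widetilde P=\widetilde P^\dagger$; unital: $\widetilde P[\mathbb 1]=\mathbb 1$; commuting with transposition: $\widetilde P[W^\tau]=\widetilde P[W]^\tau$ for all $W$. Extension: for a projector $\widetilde P_x$ on $\mathcal L(\mathcal H_x)$, an extension is a family of projectors $\widetilde P_{xa}$ on $\mathcal L(\mathcal H_x\otimes\mathcal H_a)$, one for each auxiliary space $\mathcal H_a$, with $\widetilde P_{xa}\cong\widetilde P_x$ when $\mathcal H_a\cong\mathbb C$; whenever $\widetilde P_x$ is self-adjoint (resp. unital, commuting with transposition), all members of the family are assumed to be so too. *)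

theory Defs
  imports "Jordan_Normal_Form.Schur_Decomposition"
begin

text \<open>
  A Hilbert space with a fixed computational basis is represented by its dimension \<open>n\<close>, its space
  of linear operators by the \<open>n \<times> n\<close> complex matrices, and a map between operator spaces by a
  function on matrices of which only the values on the relevant carrier matter. The product basis
  of spaces of dimensions \<open>n\<close> and \<open>d\<close> is enumerated as \<open>(i, k) \<mapsto> i * d + k\<close>.
\<close>

abbreviation ops :: "nat \<Rightarrow> complex mat set" where
  "ops n \<equiv> carrier_mat n n"

definition tr :: "complex mat \<Rightarrow> complex" where
  "tr A = (\<Sum>i<dim_row A. A $$ (i, i))"

definition kron :: "complex mat \<Rightarrow> complex mat \<Rightarrow> complex mat" where
  "kron A B = mat (dim_row A * dim_row B) (dim_col A * dim_col B)
     (\<lambda>(r, c). A $$ (r div dim_row B, c div dim_col B) * B $$ (r mod dim_row B, c mod dim_col B))"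

definition mat_unit :: "nat \<Rightarrow> nat \<Rightarrow> nat \<Rightarrow> complex mat" where
  "mat_unit n i j = mat n n (\<lambda>p. if p = (i, j) then 1 else 0)"

definition lin_map :: "nat \<Rightarrow> nat \<Rightarrow> (complex mat \<Rightarrow> complex mat) \<Rightarrow> bool" where
  "lin_map n m T \<longleftrightarrow>
     (\<forall>A\<in>ops n. T A \<in> ops m) \<and>
     (\<forall>A\<in>ops n. \<forall>B\<in>ops n. T (A + B) = T A + T B) \<and>
     (\<forall>c. \<forall>A\<in>ops n. T (c \<cdot>\<^sub>m A) = c \<cdot>\<^sub>m T A)"

text \<open>
  The tensor product of the maps \<open>T\<close> (from \<open>ops n\<close> to \<open>ops m\<close>) and \<open>S\<close> (from \<open>ops d\<close> to \<open>ops e\<close>),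
  obtained by expanding the argument in the basis of the products of matrix units; see lemmas
  \<open>tensor_map_kron\<close> and \<open>lin_map_tensor_map\<close> below.
\<close>

definition tensor_map ::
  "nat \<Rightarrow> nat \<Rightarrow> nat \<Rightarrow> nat \<Rightarrow> (complex mat \<Rightarrow> complex mat) \<Rightarrow> (complex mat \<Rightarrow> complex mat)
     \<Rightarrow> complex mat \<Rightarrow> complex mat" where
  "tensor_map n m d e T S W = mat (m * e) (m * e)
     (\<lambda>(r, c). \<Sum>i<n. \<Sum>j<n. \<Sum>k<d. \<Sum>l<d.
        W $$ (i * d + k, j * d + l) * kron (T (mat_unit n i j)) (S (mat_unit d k l)) $$ (r, c))"

definition projector :: "nat \<Rightarrow> (complex mat \<Rightarrow> complex mat) \<Rightarrow> bool" where
  "projector n P \<longleftrightarrow> lin_map n n P \<and> (\<forall>A\<in>ops n. P (P A) = P A)"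

definition is_adjoint ::
  "nat \<Rightarrow> (complex mat \<Rightarrow> complex mat) \<Rightarrow> (complex mat \<Rightarrow> complex mat) \<Rightarrow> bool" where
  "is_adjoint n P Q \<longleftrightarrow>
     (\<forall>A\<in>ops n. \<forall>B\<in>ops n. tr (mat_adjoint B * P A) = tr (mat_adjoint (Q B) * A))"

definition self_adjoint_map :: "nat \<Rightarrow> (complex mat \<Rightarrow> complex mat) \<Rightarrow> bool" where
  "self_adjoint_map n P \<longleftrightarrow> is_adjoint n P P"

definition unital :: "nat \<Rightarrow> (complex mat \<Rightarrow> complex mat) \<Rightarrow> bool" where
  "unital n P \<longleftrightarrow> P (1\<^sub>m n) = 1\<^sub>m n"

definition commutes_with_transpose :: "nat \<Rightarrow> (complex mat \<Rightarrow> complex mat) \<Rightarrow> bool" where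
  "commutes_with_transpose n P \<longleftrightarrow>
     (\<forall>W\<in>ops n. P (transpose_mat W) = transpose_mat (P W))"

text \<open>
  The type \<open>'a\<close> serves as the collection of all auxiliary spaces, \<open>da\<close> gives their dimensions.
  Distinct auxiliary spaces may have the same dimension, so that a family indexed by them need not
  be a function of the dimension alone. Every positive dimension has to occur; it does not matter
  whether a zero-dimensional space is included.
\<close>

definition auxiliary_spaces :: "('a \<Rightarrow> nat) \<Rightarrow> bool" where
  "auxiliary_spaces da \<longleftrightarrow> (\<forall>k\<ge>1. \<exists>a. da a = k)"

text \<open>
  In the second clause, \<open>ops n\<close> is identified with the operators on the tensor product with a
  one-dimensional space by means of \<open>A \<mapsto> kron A (1\<^sub>m 1)\<close>.
\<close>

definition extension ::
  "nat \<Rightarrow> (complex mat \<Rightarrow> complex mat) \<Rightarrow> ('a \<Rightarrow> nat) \<Rightarrow> ('a \<Rightarrow> complex mat \<Rightarrow> complex mat) \<Rightarrow> bool"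
  where
  "extension n P da Pa \<longleftrightarrow>
     (\<forall>a. projector (n * da a) (Pa a)) \<and>
     (\<forall>a. da a = 1 \<longrightarrow> (\<forall>A\<in>ops n. Pa a (kron A (1\<^sub>m 1)) = kron (P A) (1\<^sub>m 1))) \<and>
     (self_adjoint_map n P \<longrightarrow> (\<forall>a. self_adjoint_map (n * da a) (Pa a))) \<and>
     (unital n P \<longrightarrow> (\<forall>a. unital (n * da a) (Pa a))) \<and>
     (commutes_with_transpose n P \<longrightarrow> (\<forall>a. commutes_with_transpose (n * da a) (Pa a)))"

definition trace_rescaling ::
  "nat \<Rightarrow> (complex mat \<Rightarrow> complex mat) \<Rightarrow> complex \<Rightarrow> complex \<Rightarrow> (complex mat \<Rightarrow> complex mat) \<Rightarrow> bool"
  where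
  "trace_rescaling n P g_in g_out T \<longleftrightarrow>
     (\<forall>W\<in>ops n. P W = W \<and> tr W = g_in \<longrightarrow> tr (T W) = g_out / g_in * tr W)"

definition completely_trace_rescaling ::
  "nat \<Rightarrow> nat \<Rightarrow> ('a \<Rightarrow> nat) \<Rightarrow> ('a \<Rightarrow> complex mat \<Rightarrow> complex mat) \<Rightarrow> ('a \<Rightarrow> complex) \<Rightarrow> ('a \<Rightarrow> complex)
     \<Rightarrow> (complex mat \<Rightarrow> complex mat) \<Rightarrow> bool"
  where
  "completely_trace_rescaling n m da Pa g_in g_out T \<longleftrightarrow>
     (\<forall>a. trace_rescaling (n * da a) (Pa a) (g_in a) (g_out a)
            (tensor_map n m (da a) (da a) T (\<lambda>B. B)))"

lemma kron_carrier: "A \<in> ops n \<Longrightarrow> B \<in> ops d \<Longrightarrow> kron A B \<in> ops (n * d)"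
  by (auto simp: kron_def)

lemma tensor_index_less:
  fixes i k n d :: nat
  assumes "i < n" "k < d"
  shows "i * d + k < n * d"
proof -
  have "i * d + k < Suc i * d" using assms by simp
  also have "\<dots> \<le> n * d" using assms by (intro mult_le_mono1) simp
  finally show ?thesis .
qed

lemma kron_index:
  assumes "A \<in> ops n" "B \<in> ops d" "i < n" "j < n" "k < d" "l < d"
  shows "kron A B $$ (i * d + k, j * d + l) = A $$ (i, j) * B $$ (k, l)"
  using assms tensor_index_less[of i n k d] tensor_index_less[of j n l d]
  by (auto simp: kron_def)

lemma kron_one: "A \<in> ops n \<Longrightarrow> kron A (1\<^sub>m 1) = A"
  by (rule eq_matI) (auto simp: kron_def)

lemma lin_map_expand:
  assumes T: "lin_map n m T" and A: "A \<in> ops n" and "r < m" "c < m"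
  shows "T A $$ (r, c) = (\<Sum>i<n. \<Sum>j<n. A $$ (i, j) * T (mat_unit n i j) $$ (r, c))"
proof -
  define M where "M S = mat n n (\<lambda>p. if p \<in> S then A $$ p else 0)" for S
  have M: "M S \<in> ops n" for S by (simp add: M_def)
  have U: "mat_unit n i j \<in> ops n" for i j by (simp add: mat_unit_def)
  have TC: "T X \<in> ops m" if "X \<in> ops n" for X using T that by (auto simp: lin_map_def)
  have "T (M S) $$ (r, c) = (\<Sum>p\<in>S. A $$ p * T (mat_unit n (fst p) (snd p)) $$ (r, c))"
    if "finite S" for S
    using that
  proof (induction S)
    case empty
    have "M {} = 0 \<cdot>\<^sub>m M {}" by (rule eq_matI) (auto simp: M_def)
    then have "T (M {}) = 0 \<cdot>\<^sub>m T (M {})" using T M by (metis lin_map_def)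
    then have "T (M {}) $$ (r, c) = (0 \<cdot>\<^sub>m T (M {})) $$ (r, c)" by simp
    then show ?case using TC[OF M[of "{}"]] assms by auto
  next
    case (insert p S)
    have "M (insert p S) = A $$ p \<cdot>\<^sub>m mat_unit n (fst p) (snd p) + M S"
      using insert by (intro eq_matI) (auto simp: M_def mat_unit_def)
    then have "T (M (insert p S)) = A $$ p \<cdot>\<^sub>m T (mat_unit n (fst p) (snd p)) + T (M S)"
      using T M U by (simp add: lin_map_def)
    then show ?case
      using insert TC[OF M[of S]] TC[OF U[of "fst p" "snd p"]] assms by auto
  qed
  from this[of "{..<n} \<times> {..<n}"]
  have "T (M ({..<n} \<times> {..<n})) $$ (r, c) = 
      (\<Sum>i<n. \<Sum>j<n. A $$ (i, j) * T (mat_unit n i j) $$ (r, c))"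
    by (simp add: sum.cartesian_product case_prod_unfold)
  moreover have "M ({..<n} \<times> {..<n}) = A" using A by (intro eq_matI) (auto simp: M_def)
  ultimately show ?thesis by simp
qed

lemma tensor_map_kron:
  assumes T: "lin_map n m T" and S: "lin_map d e S" and A: "A \<in> ops n" and B: "B \<in> ops d"
  shows "tensor_map n m d e T S (kron A B) = kron (T A) (S B)"
proof (rule eq_matI)
  have TA: "T A \<in> ops m" and SB: "S B \<in> ops e" using assms by (auto simp: lin_map_def)
  have TU: "T (mat_unit n i j) \<in> ops m" for i j
    using T by (auto simp: lin_map_def mat_unit_def)
  have SU: "S (mat_unit d i j) \<in> ops e" for i j
    using S by (auto simp: lin_map_def mat_unit_def)
  show "dim_row (tensor_map n m d e T S (kron A B)) = dim_row (kron (T A) (S B))"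
    "dim_col (tensor_map n m d e T S (kron A B)) = dim_col (kron (T A) (S B))"
    using TA SB by (auto simp: tensor_map_def kron_def)
  fix r c
  assume "r < dim_row (kron (T A) (S B))" "c < dim_col (kron (T A) (S B))"
  then have rc: "r < m * e" "c < m * e" using TA SB by (auto simp: kron_def)
  then have b: "r div e < m" "c div e < m" "r mod e < e" "c mod e < e"
    by (auto simp: less_mult_imp_div_less intro!: mod_less_divisor Nat.gr0I)
  let ?t = "\<lambda>i j. T (mat_unit n i j) $$ (r div e, c div e)"
  let ?s = "\<lambda>k l. S (mat_unit d k l) $$ (r mod e, c mod e)"
  have "tensor_map n m d e T S (kron A B) $$ (r, c) =
      (\<Sum>i<n. \<Sum>j<n. \<Sum>k<d. \<Sum>l<d. kron A B $$ (i * d + k, j * d + l) *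
         kron (T (mat_unit n i j)) (S (mat_unit d k l)) $$ (r, c))"
    using rc by (simp add: tensor_map_def)
  also have "\<dots> = (\<Sum>i<n. \<Sum>j<n. \<Sum>k<d. \<Sum>l<d. (A $$ (i, j) * ?t i j) * (B $$ (k, l) * ?s k l))"
  proof (intro sum.cong refl)
    fix i j k l assume "i \<in> {..<n}" "j \<in> {..<n}" "k \<in> {..<d}" "l \<in> {..<d}"
    moreover have "kron (T (mat_unit n i j)) (S (mat_unit d k l)) $$ (r, c) = ?t i j * ?s k l"
      using rc TU[of i j] SU[of k l] by (auto simp: kron_def)
    ultimately show "kron A B $$ (i * d + k, j * d + l) *
         kron (T (mat_unit n i j)) (S (mat_unit d k l)) $$ (r, c) =
        (A $$ (i, j) * ?t i j) * (B $$ (k, l) * ?s k l)"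
      by (simp add: kron_index[OF A B])
  qed
  also have "\<dots> = (\<Sum>i<n. \<Sum>j<n. A $$ (i, j) * ?t i j) * (\<Sum>k<d. \<Sum>l<d. B $$ (k, l) * ?s k l)"
    by (simp only: sum_distrib_left[symmetric] sum_distrib_right[symmetric])
  also have "\<dots> = T A $$ (r div e, c div e) * S B $$ (r mod e, c mod e)"
    by (simp only: lin_map_expand[OF T A b(1,2)] lin_map_expand[OF S B b(3,4)])
  also have "\<dots> = kron (T A) (S B) $$ (r, c)"
    using rc TA SB by (auto simp: kron_def)
  finally show "tensor_map n m d e T S (kron A B) $$ (r, c) = kron (T A) (S B) $$ (r, c)" .
qed

lemma lin_map_tensor_map: "lin_map (n * d) (m * e) (tensor_map n m d e T S)"
proof -
  have C: "tensor_map n m d e T S A \<in> ops (m * e)" for A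
    by (simp add: tensor_map_def)
  have smult: "tensor_map n m d e T S (a \<cdot>\<^sub>m A) = a \<cdot>\<^sub>m tensor_map n m d e T S A"
    if A: "A \<in> ops (n * d)" for a A
  proof (rule eq_matI)
    fix r c assume "r < dim_row (a \<cdot>\<^sub>m tensor_map n m d e T S A)"
      "c < dim_col (a \<cdot>\<^sub>m tensor_map n m d e T S A)"
    then have rc: "r < m * e" "c < m * e" by (simp_all add: tensor_map_def)
    have "(a \<cdot>\<^sub>m A) $$ (i * d + k, j * d + l) = a * A $$ (i * d + k, j * d + l)"
      if "i < n" "j < n" "k < d" "l < d" for i j k l
      using A that by (simp add: tensor_index_less)
    then show "tensor_map n m d e T S (a \<cdot>\<^sub>m A) $$ (r, c) = (a \<cdot>\<^sub>m tensor_map n m d e T S A) $$ (r, c)"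
      using rc by (simp add: tensor_map_def sum_distrib_left mult.assoc)
  qed (simp_all add: tensor_map_def)
  have add: "tensor_map n m d e T S (A + B) = tensor_map n m d e T S A + tensor_map n m d e T S B"
    if A: "A \<in> ops (n * d)" and B: "B \<in> ops (n * d)" for A B
  proof (rule eq_matI)
    fix r c assume "r < dim_row (tensor_map n m d e T S A + tensor_map n m d e T S B)"
      "c < dim_col (tensor_map n m d e T S A + tensor_map n m d e T S B)"
    then have rc: "r < m * e" "c < m * e" by (simp_all add: tensor_map_def)
    have "(A + B) $$ (i * d + k, j * d + l) = A $$ (i * d + k, j * d + l) + B $$ (i * d + k, j * d + l)"
      if "i < n" "j < n" "k < d" "l < d" for i j k l
      using A B that by (simp add: tensor_index_less)
    then show "tensor_map n m d e T S (A + B) $$ (r, c)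
        = (tensor_map n m d e T S A + tensor_map n m d e T S B) $$ (r, c)"
      using rc by (simp add: tensor_map_def distrib_right sum.distrib)
  qed (simp_all add: tensor_map_def)
  show ?thesis
    unfolding lin_map_def using C smult add by blast
qed

end

theory Submission
  imports Defs
begin

text \<open>
  Let \<open>V\<close> be the partial trace of \<open>W\<close> over the auxiliary space. It is characterised by
  \<open>tr (X\<^sup>\<dagger> V) = tr ((X \<otimes> 1)\<^sup>\<dagger> W)\<close> for all \<open>X\<close>, so moving the self-adjoint projectors across the
  trace form turns the hypothesis on \<open>X \<otimes> 1\<close> into the statement that \<open>V\<close> is fixed by \<open>P\<close> whenever
  \<open>W\<close> is fixed by its extension. Moreover \<open>tr V = tr W\<close> and \<open>T \<otimes> 1\<close> sends \<open>W\<close> to an operator of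
  trace \<open>tr (T V)\<close>, so the claim is trace-rescaling of \<open>T\<close> at a multiple of \<open>V\<close>.
\<close>

definition partial_trace :: "nat \<Rightarrow> nat \<Rightarrow> complex mat \<Rightarrow> complex mat" where
  "partial_trace n d W = mat n n (\<lambda>(i, j). \<Sum>k<d. W $$ (i * d + k, j * d + k))"

lemma partial_trace_carrier [simp]: "partial_trace n d W \<in> ops n"
  by (simp add: partial_trace_def)

lemma sum_tensor_index:
  fixes f :: "nat \<Rightarrow> 'b::comm_monoid_add"
  shows "sum f {..<n * d} = (\<Sum>i<n. \<Sum>k<d. f (i * d + k))"
proof -
  have "sum f {i * d..<i * d + d} = (\<Sum>k<d. f (i * d + k))" for i
    using sum.shift_bounds_nat_ivl[of f 0 "i * d" d]
    by (simp add: add.commute atLeast0LessThan)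
  then show ?thesis
    by (simp flip: sum.nat_group)
qed

lemma tr_smult: "tr (c \<cdot>\<^sub>m A) = c * tr A" if "A \<in> ops n"
  using that by (simp add: tr_def sum_distrib_left)

lemma tr_adjoint_mult:
  assumes "A \<in> ops n" "B \<in> ops n"
  shows "tr (mat_adjoint B * A) = (\<Sum>i<n. \<Sum>j<n. cnj (B $$ (j, i)) * A $$ (j, i))"
  using assms
  by (simp add: tr_def mat_adjoint_def mat_of_rows_def scalar_prod_def atLeast0LessThan)

text \<open>The trace form is the Hilbert-Schmidt inner product, hence nondegenerate: testing
  against the matrix unit at \<open>(r, c)\<close> reads off the entry at
  \<open>(r, c)\<close>.\<close>

lemma eq_if_tr_adjoint_mult_eq:
  assumes A: "A \<in> ops n" and B: "B \<in> ops n"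
    and eq: "\<And>X. X \<in> ops n \<Longrightarrow> tr (mat_adjoint X * A) = tr (mat_adjoint X * B)"
  shows "A = B"
proof -
  have entry: "tr (mat_adjoint (mat_unit n r c) * C) = C $$ (r, c)"
    if C: "C \<in> ops n" and rc: "r < n" "c < n" for C r c
  proof -
    have U: "mat_unit n r c \<in> ops n" by (simp add: mat_unit_def)
    \<comment> \<open>The condition \<open>(j, i) = (r, c)\<close> is split into nested conditionals
      so that each of the two sums collapses separately.\<close>
    have "tr (mat_adjoint (mat_unit n r c) * C)
        = (\<Sum>i<n. \<Sum>j<n. if i = c then if j = r then C $$ (j, i) else 0 else 0)"
      unfolding tr_adjoint_mult[OF C U] by (intro sum.cong refl) (simp add: mat_unit_def)
    also have "\<dots> = (\<Sum>i<n. if i = c then \<Sum>j<n. if j = r then C $$ (j, i) else 0 else 0)"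
      by (intro sum.cong refl) simp
    also have "\<dots> = C $$ (r, c)" using rc by simp
    finally show ?thesis .
  qed
  have "A $$ (r, c) = B $$ (r, c)" if "r < n" "c < n" for r c
    using eq[of "mat_unit n r c"] entry[OF A that] entry[OF B that] by (simp add: mat_unit_def)
  then show ?thesis using A B by (intro eq_matI) auto
qed

lemma tr_partial_trace:
  assumes "W \<in> ops (n * d)"
  shows "tr (partial_trace n d W) = tr W"
  using assms by (simp add: tr_def partial_trace_def sum_tensor_index)

text \<open>The identity factor contributes a Kronecker delta in the auxiliary indices, and what
  survives is the sum over diagonal auxiliary entries of \<open>W\<close>. Thus the partial trace is
  the Hilbert-Schmidt adjoint of tensoring with the identity.\<close>

lemma tr_adjoint_kron_one_mult:
  assumes X: "X \<in> ops n" and W: "W \<in> ops (n * d)"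
  shows "tr (mat_adjoint (kron X (1\<^sub>m d)) * W) = tr (mat_adjoint X * partial_trace n d W)"
proof -
  have K: "kron X (1\<^sub>m d) \<in> ops (n * d)" using X by (simp add: kron_carrier)
  have "tr (mat_adjoint (kron X (1\<^sub>m d)) * W) =
      (\<Sum>i<n. \<Sum>k<d. \<Sum>j<n. \<Sum>l<d.
         cnj (kron X (1\<^sub>m d) $$ (j * d + l, i * d + k)) * W $$ (j * d + l, i * d + k))"
    unfolding tr_adjoint_mult[OF W K] sum_tensor_index ..
  also have "\<dots> = (\<Sum>i<n. \<Sum>k<d. \<Sum>j<n. \<Sum>l<d.
         if l = k then cnj (X $$ (j, i)) * W $$ (j * d + l, i * d + k) else 0)"
    by (intro sum.cong refl) (use X in \<open>simp add: kron_index[of _ n _ d]\<close>)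
  also have "\<dots> = (\<Sum>i<n. \<Sum>k<d. \<Sum>j<n. cnj (X $$ (j, i)) * W $$ (j * d + k, i * d + k))"
    by (intro sum.cong refl) simp
  also have "\<dots> = (\<Sum>i<n. \<Sum>j<n. \<Sum>k<d. cnj (X $$ (j, i)) * W $$ (j * d + k, i * d + k))"
    by (intro sum.cong refl sum.swap)
  also have "\<dots> = tr (mat_adjoint X * partial_trace n d W)"
    unfolding tr_adjoint_mult[OF partial_trace_carrier X]
    by (intro sum.cong refl) (simp add: partial_trace_def sum_distrib_left)
  finally show ?thesis .
qed

lemma tr_tensor_map_id:
  assumes T: "lin_map n m T"
  shows "tr (tensor_map n m d d T (\<lambda>B. B) W) = tr (T (partial_trace n d W))"
proof -
  have TU: "T (mat_unit n i j) \<in> ops m" for i j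
    using T by (auto simp: lin_map_def mat_unit_def)
  \<comment> \<open>Summing over \<open>q\<close> traces out the auxiliary factor, and a matrix unit
    on that factor has trace 1 if \<open>l = k\<close> and 0 otherwise.\<close>
  have entry: "(\<Sum>q<d. kron (T (mat_unit n i j)) (mat_unit d k l) $$ (p * d + q, p * d + q))
      = (if l = k then T (mat_unit n i j) $$ (p, p) else 0)"
    if "p < m" "k < d" "l < d" for i j k l p
  proof -
    have "(\<Sum>q<d. kron (T (mat_unit n i j)) (mat_unit d k l) $$ (p * d + q, p * d + q))
        = (\<Sum>q<d. if q = k then if l = k then T (mat_unit n i j) $$ (p, p) else 0 else 0)"
      by (intro sum.cong refl)
        (use that TU[of i j] in \<open>auto simp: kron_index[of _ m _ d] mat_unit_def\<close>)
    then show ?thesis using that by simp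
  qed
  have "tr (tensor_map n m d d T (\<lambda>B. B) W) =
      (\<Sum>p<m. \<Sum>q<d. \<Sum>i<n. \<Sum>j<n. \<Sum>k<d. \<Sum>l<d. W $$ (i * d + k, j * d + l) *
         kron (T (mat_unit n i j)) (mat_unit d k l) $$ (p * d + q, p * d + q))"
    by (simp add: tr_def tensor_map_def sum_tensor_index tensor_index_less)
  also have "\<dots> = (\<Sum>p<m. \<Sum>i<n. \<Sum>j<n. \<Sum>k<d. \<Sum>l<d. W $$ (i * d + k, j * d + l) *
         (\<Sum>q<d. kron (T (mat_unit n i j)) (mat_unit d k l) $$ (p * d + q, p * d + q)))"
    \<comment> \<open>The sum over \<open>q\<close> is moved inwards past \<open>i\<close>,
      \<open>j\<close>, \<open>k\<close> and \<open>l\<close>, one swap each.\<close>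
    unfolding sum_distrib_left
    by (rule sum.cong[OF refl], rule trans[OF sum.swap], rule sum.cong[OF refl],
        rule trans[OF sum.swap], rule sum.cong[OF refl], rule trans[OF sum.swap],
        rule sum.cong[OF refl], rule sum.swap)
  also have "\<dots> = (\<Sum>p<m. \<Sum>i<n. \<Sum>j<n. \<Sum>k<d. \<Sum>l<d.
         if l = k then W $$ (i * d + k, j * d + l) * T (mat_unit n i j) $$ (p, p) else 0)"
    by (intro sum.cong refl) (simp add: entry)
  also have "\<dots> = (\<Sum>p<m. \<Sum>i<n. \<Sum>j<n.
         partial_trace n d W $$ (i, j) * T (mat_unit n i j) $$ (p, p))"
    by (intro sum.cong refl) (simp add: partial_trace_def sum_distrib_right)
  also have "\<dots> = (\<Sum>p<m. T (partial_trace n d W) $$ (p, p))"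
    by (intro sum.cong refl) (simp add: lin_map_expand[OF T partial_trace_carrier])
  also have "\<dots> = tr (T (partial_trace n d W))"
    using T by (auto simp: tr_def lin_map_def dest!: bspec[OF _ partial_trace_carrier[of n d W]])
  finally show ?thesis .
qed

lemma partial_trace_fixed:
  assumes P: "lin_map n n P" "self_adjoint_map n P"
    and Q: "self_adjoint_map (n * d) Q"
    and ext: "\<And>X. X \<in> ops n \<Longrightarrow> Q (kron X (1\<^sub>m d)) = kron (P X) (1\<^sub>m d)"
    and W: "W \<in> ops (n * d)" "Q W = W"
  shows "P (partial_trace n d W) = partial_trace n d W"
proof (rule eq_if_tr_adjoint_mult_eq)
  let ?V = "partial_trace n d W"
  show "P ?V \<in> ops n" using P(1) by (simp add: lin_map_def)
  fix X assume X: "X \<in> ops n"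
  then have PX: "P X \<in> ops n" and K: "kron X (1\<^sub>m d) \<in> ops (n * d)"
    using P(1) by (auto simp: lin_map_def kron_carrier)
  \<comment> \<open>Self-adjointness moves \<open>P\<close> onto the test operator. There
    \<open>ext\<close> trades it for \<open>Q\<close>, which is moved back onto \<open>W\<close> and
    absorbed.\<close>
  have "tr (mat_adjoint X * P ?V) = tr (mat_adjoint (P X) * ?V)"
    using P(2) X by (simp add: self_adjoint_map_def is_adjoint_def)
  also have "\<dots> = tr (mat_adjoint (Q (kron X (1\<^sub>m d))) * W)"
    using tr_adjoint_kron_one_mult[OF PX W(1)] ext[OF X] by simp
  also have "\<dots> = tr (mat_adjoint (kron X (1\<^sub>m d)) * Q W)"
    using Q K W(1) by (simp add: self_adjoint_map_def is_adjoint_def)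
  also have "\<dots> = tr (mat_adjoint X * ?V)"
    using tr_adjoint_kron_one_mult[OF X W(1)] W(2) by simp
  finally show "tr (mat_adjoint X * P ?V) = tr (mat_adjoint X * ?V)" .
qed simp

text \<open>Trace-rescaling is only tested at trace exactly \<open>g_in\<close>. Fixed points of
  \<open>P\<close> are closed under scaling, so by linearity the identity carries over to any fixed
  point that can be scaled to that trace.\<close>

lemma trace_rescaling_scaled:
  assumes P: "lin_map n n P" and T: "lin_map n m T" and tr: "trace_rescaling n P g_in g_out T"
    and g: "g_in \<noteq> 0" and V: "V \<in> ops n" "P V = V" "tr V \<noteq> 0"
  shows "tr (T V) = g_out / g_in * tr V"
proof -
  define c where "c = g_in / tr V"
  have c: "c \<noteq> 0" using g V(3) by (simp add: c_def)
  have "P (c \<cdot>\<^sub>m V) = c \<cdot>\<^sub>m V" using P V by (simp add: lin_map_def)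
  moreover have "tr (c \<cdot>\<^sub>m V) = g_in" using tr_smult[OF V(1)] V(3) by (simp add: c_def)
  ultimately have "tr (T (c \<cdot>\<^sub>m V)) = g_out / g_in * tr (c \<cdot>\<^sub>m V)"
    using tr V(1) by (simp add: trace_rescaling_def)
  moreover have "tr (T (c \<cdot>\<^sub>m V)) = c * tr (T V)"
    using T V(1) tr_smult[of "T V" m] by (simp add: lin_map_def)
  ultimately have "c * tr (T V) = c * (g_out / g_in * tr V)"
    by (simp add: tr_smult[OF V(1)] mult.left_commute)
  then show ?thesis using c mult_left_cancel by blast
qed

theorem lemma2:
  fixes ni no :: nat
    and da :: "'a \<Rightarrow> nat"
    and P :: "complex mat \<Rightarrow> complex mat"
    and Pa :: "'a \<Rightarrow> complex mat \<Rightarrow> complex mat"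
    and \<gamma>i \<gamma>o :: complex
    and \<gamma>ia \<gamma>oa :: "'a \<Rightarrow> complex"
  assumes "auxiliary_spaces da"
    and "projector ni P"
    and "self_adjoint_map ni P"
    and "unital ni P"
    and "commutes_with_transpose ni P"
    and "extension ni P da Pa"
    and "\<gamma>i \<noteq> 0" and "\<gamma>o \<noteq> 0"
    and "\<And>a. \<gamma>ia a \<noteq> 0" and "\<And>a. \<gamma>oa a \<noteq> 0"
    and "\<And>a. \<gamma>oa a / \<gamma>ia a = \<gamma>o / \<gamma>i"
    and "\<And>a X. X \<in> ops ni \<Longrightarrow> Pa a (kron X (1\<^sub>m (da a))) = kron (P X) (1\<^sub>m (da a))"
  shows "\<forall>T. lin_map ni no T \<longrightarrow> trace_rescaling ni P \<gamma>i \<gamma>o T \<longrightarrow>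
           completely_trace_rescaling ni no da Pa \<gamma>ia \<gamma>oa T"
proof (intro allI impI)
  fix T assume T: "lin_map ni no T" and tr: "trace_rescaling ni P \<gamma>i \<gamma>o T"
  have P: "lin_map ni ni P" using assms(2) by (simp add: projector_def)
  show "completely_trace_rescaling ni no da Pa \<gamma>ia \<gamma>oa T"
    unfolding completely_trace_rescaling_def trace_rescaling_def
  proof (intro allI ballI impI, elim conjE)
    fix a W
    assume W: "W \<in> ops (ni * da a)" "Pa a W = W" "tr W = \<gamma>ia a"
    let ?V = "partial_trace ni (da a) W"
    have Q: "self_adjoint_map (ni * da a) (Pa a)"
      using assms(3,6) by (simp add: extension_def)
    have trV: "tr ?V = tr W" by (rule tr_partial_trace[OF W(1)])
    have "P ?V = ?V" by (rule partial_trace_fixed[OF P assms(3) Q assms(12) W(1,2)])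
    \<comment> \<open>The trace of \<open>?V\<close> is \<open>\<gamma>ia a\<close>, which may
      differ from \<open>\<gamma>i\<close> but is nonzero, so the scaled form of trace-rescaling
      applies.\<close>
    then have "tr (T ?V) = \<gamma>o / \<gamma>i * tr ?V"
      using trV W(3) assms(9) by (intro trace_rescaling_scaled[OF P T tr assms(7)]) simp_all
    \<comment> \<open>The factor obtained is \<open>\<gamma>o / \<gamma>i\<close>; equality of the
      ratios turns it into the one for the auxiliary space \<open>a\<close>.\<close>
    then show "tr (tensor_map ni no (da a) (da a) T (\<lambda>B. B) W) = \<gamma>oa a / \<gamma>ia a * tr W"
      by (simp only: tr_tensor_map_id[OF T] trV assms(11))
  qed
qed

end
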